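(* Let $I\subset\mathbb{R}$ be an interval, let $p\in\mathbb{R}\setminus\{0\}$, let $\alpha>0$, let $u:I\to\mathbb{R}$ be hyperbolic $p$-convex on $I$, and let $a,b\in I$ with $a<b$. Let $v:I\to\mathbb{R}$ be a function which on $[a,b]$ is positive, symmetric (that is, $v(a+b-x)=v(x)$ for $x\in[a,b]$) and integrable. Then $$u\left(\frac{a+b}{2}\right)\mathcal{C}^1_\alpha(v)\;\leq\; I^\alpha_{a+}[uv](b)+I^\alpha_{b-}[uv](a)\;\leq\;\frac{u(a)+u(b)}{2}\cdot\frac{1}{\cosh\left(\frac{p(b-a)}{2}\right)}\,\mathcal{C}^1_\alpha(v),$$ where $$\mathcal{C}^1_{\alpha}(v):=\int_a^b\cosh\left[p\left(x-\frac{a+b}{2}\right)\right]\frac{(b-x)^{\alpha-1}+(x-a)^{\alpha-1}}{\Gamma(\alpha)}\,v(x)\,dx.$$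
   Context: A function $f:I\to\mathbb{R}$ is hyperbolic $p$-convex on $I$ if for every closed subinterval $[a,b]\subset I$ (with $a<b$) and all $x\in[a,b]$, $$f(x)\leq \frac{\sinh[p(b-x)]}{\sinh[p(b-a)]}f(a)+\frac{\sinh[p(x-a)]}{\sinh[p(b-a)]}f(b).$$ The Riemann--Liouville fractional integrals of order $\alpha>0$ are $I^\alpha_{a+}[f](t)=\frac{1}{\Gamma(\alpha)}\int_a^t(t-s)^{\alpha-1}f(s)\,ds$ for $t\in(a,b]$ and $I^\alpha_{b-}[f](t)=\frac{1}{\Gamma(\alpha)}\int_t^b(s-t)^{\alpha-1}f(s)\,ds$ for $t\in[a,b)$, where $\Gamma$ is the Euler gamma function; $uv$ denotes the pointwise product.
   Formalization: For 0 < α < 1 it is additionally assumed that the integral defining C¹_α(v) converges; integrability of v alone does not ensure this, e.g. v(x) = ((b−x)(x−a))^(−α) makes it infinite. *)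

theory Defs
  imports "HOL-Analysis.Analysis"
begin

definition hyperbolic_convex_on :: "real \<Rightarrow> real set \<Rightarrow> (real \<Rightarrow> real) \<Rightarrow> bool" where
  "hyperbolic_convex_on p I f \<longleftrightarrow>
     (\<forall>a b. a < b \<and> {a..b} \<subseteq> I \<longrightarrow>
       (\<forall>x\<in>{a..b}. f x \<le> sinh (p * (b - x)) / sinh (p * (b - a)) * f a
                        + sinh (p * (x - a)) / sinh (p * (b - a)) * f b))"

text \<open>
  All integrals are Lebesgue integrals. Where a kernel has base zero, at an endpoint of the
  interval of integration, \<open>powr\<close> returns 0; this affects a null set only.
\<close>

definition RL_left :: "real \<Rightarrow> real \<Rightarrow> (real \<Rightarrow> real) \<Rightarrow> real \<Rightarrow> real" where
  "RL_left \<alpha> a f t =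
     1 / Gamma \<alpha> * (LINT s:{a..t}|lebesgue. (t - s) powr (\<alpha> - 1) * f s)"

definition RL_right :: "real \<Rightarrow> real \<Rightarrow> (real \<Rightarrow> real) \<Rightarrow> real \<Rightarrow> real" where
  "RL_right \<alpha> b f t =
     1 / Gamma \<alpha> * (LINT s:{t..b}|lebesgue. (s - t) powr (\<alpha> - 1) * f s)"

definition C1_integrand ::
    "real \<Rightarrow> real \<Rightarrow> real \<Rightarrow> real \<Rightarrow> (real \<Rightarrow> real) \<Rightarrow> real \<Rightarrow> real" where
  "C1_integrand p \<alpha> a b v x =
     cosh (p * (x - (a + b) / 2)) *
     (((b - x) powr (\<alpha> - 1) + (x - a) powr (\<alpha> - 1)) / Gamma \<alpha>) * v x"

definition C1 :: "real \<Rightarrow> real \<Rightarrow> real \<Rightarrow> real \<Rightarrow> (real \<Rightarrow> real) \<Rightarrow> real" where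
  "C1 p \<alpha> a b v = (LINT x:{a..b}|lebesgue. C1_integrand p \<alpha> a b v x)"

end

theory Submission
  imports Defs
begin

text \<open>
  Let \<open>w x = ((b - x) powr (\<alpha> - 1) + (x - a) powr (\<alpha> - 1)) * v x\<close>, which is nonnegative and
  symmetric about the midpoint \<open>m\<close> of \<open>[a, b]\<close>. Up to the factor \<open>1 / Gamma \<alpha>\<close> the two fractional
  integrals add up to the integral of \<open>u * w\<close>, and \<open>C1\<close> is, up to the same factor, the integral of
  \<open>cosh (p * (x - m)) * w x\<close>. By the symmetry of \<open>w\<close>, the integral of \<open>u * w\<close> does not change
  when \<open>u x\<close> is replaced by the average of \<open>u x\<close> and \<open>u (a + b - x)\<close>. This average satisfies

    \<open>cosh (p * (x - m)) * u m
      \<le> (u x + u (a + b - x)) / 2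
      \<le> cosh (p * (x - m)) / cosh (p * (b - a) / 2) * (u a + u b) / 2\<close>.

  The left inequality is convexity on the interval between \<open>x\<close> and its mirror image, evaluated at
  \<open>m\<close>; the right one adds the convexity inequalities on \<open>[a, b]\<close> at \<open>x\<close> and at its mirror image
  (\<open>hyperbolic_convex_on_reflected_sum_ge\<close> and \<open>hyperbolic_convex_on_reflected_sum_le\<close>).
  Multiplying by \<open>w\<close> and integrating proves the theorem.

  The remaining work is to show that the integrals exist, since a Lebesgue integral of a
  non-integrable function is 0 by convention. For \<open>u * w\<close> this rests on two facts about \<open>u\<close>.
  It is bounded on \<open>[a, b]\<close> (\<open>hyperbolic_convex_on_imp_bounded\<close>), and it is continuous on the
  open interval (\<open>hyperbolic_convex_on_imp_continuous_on\<close>), hence measurable: in the coordinate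
  \<open>tanh (p * x)\<close>, the quotient \<open>u x / cosh (p * x)\<close> is an ordinary convex function.
\<close>

section \<open>Inequalities for hyperbolic convex functions\<close>

text \<open>
  The weights are even in \<open>p\<close>. Monotonicity arguments for \<open>sinh\<close> and \<open>tanh\<close> can therefore assume
  \<open>p > 0\<close>.
\<close>

lemma hyperbolic_convex_on_uminus:
  "hyperbolic_convex_on (- p) I f \<longleftrightarrow> hyperbolic_convex_on p I f"
  by (simp add: hyperbolic_convex_on_def)

lemma hyperbolic_convex_on_abs:
  "hyperbolic_convex_on \<bar>p\<bar> I f \<longleftrightarrow> hyperbolic_convex_on p I f"
  by (simp add: abs_if hyperbolic_convex_on_uminus)

lemma hyperbolic_convex_on_subset:
  "hyperbolic_convex_on p I f \<Longrightarrow> J \<subseteq> I \<Longrightarrow> hyperbolic_convex_on p J f"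
  unfolding hyperbolic_convex_on_def by blast

lemma hyperbolic_convex_onD:
  assumes "hyperbolic_convex_on p I f" "a < b" "{a..b} \<subseteq> I" "x \<in> {a..b}"
  shows "f x \<le> sinh (p * (b - x)) / sinh (p * (b - a)) * f a
               + sinh (p * (x - a)) / sinh (p * (b - a)) * f b"
  using assms unfolding hyperbolic_convex_on_def by blast

text \<open>
  If \<open>x\<close> is not the midpoint, then on the interval between \<open>x\<close> and \<open>a + b - x\<close> the midpoint is at
  distance \<open>d = \<bar>(a + b) / 2 - x\<bar>\<close> from both ends, so that both values get the weight
  \<open>sinh (p * d) / sinh (2 * (p * d)) = 1 / (2 * cosh (p * d))\<close>.
\<close>

lemma hyperbolic_convex_on_reflected_sum_ge:
  assumes u: "hyperbolic_convex_on p {a..b} u" and p: "p \<noteq> 0" and x: "x \<in> {a..b}"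
  shows "2 * cosh (p * (x - (a + b) / 2)) * u ((a + b) / 2) \<le> u x + u (a + b - x)"
proof -
  let ?m = "(a + b) / 2"
  have left: "2 * cosh (p * (y - ?m)) * u ?m \<le> u y + u (a + b - y)"
    if y: "y \<in> {a..b}" "y < ?m" for y
  proof -
    let ?d = "p * (?m - y)"
    have d: "?d \<noteq> 0" using p y by simp
    have "u ?m \<le> sinh (p * (a + b - y - ?m)) / sinh (p * (a + b - y - y)) * u y
               + sinh ?d / sinh (p * (a + b - y - y)) * u (a + b - y)"
      by (rule hyperbolic_convex_onD[OF u]) (use y in auto)
    moreover have "p * (a + b - y - ?m) = ?d" "p * (a + b - y - y) = 2 * ?d"
      by (simp_all add: field_simps)
    ultimately have "u ?m \<le> sinh ?d / sinh (2 * ?d) * (u y + u (a + b - y))"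
      by (simp only: distrib_left)
    also have "sinh ?d / sinh (2 * ?d) = 1 / (2 * cosh ?d)"
      using d unfolding sinh_double by simp
    finally have "2 * cosh ?d * u ?m \<le> u y + u (a + b - y)"
      by (simp add: field_simps)
    moreover have "cosh (p * (y - ?m)) = cosh ?d"
      using cosh_minus[of ?d] by (simp only: mult_minus_right[symmetric] minus_diff_eq)
    ultimately show ?thesis by (simp only:)
  qed
  consider "x < ?m" | "x = ?m" | "x > ?m" by linarith
  then show ?thesis
  proof cases
    case 1
    then show ?thesis using left x by blast
  next
    case 2
    then have "a + b - x = x" by (simp add: field_simps)
    with 2 show ?thesis by simp
  next
    case 3
    have "p * (a + b - x - ?m) = - (p * (x - ?m))" by (simp add: field_simps)
    then have "cosh (p * (a + b - x - ?m)) = cosh (p * (x - ?m))"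
      by (simp only: cosh_minus)
    with left[of "a + b - x"] x 3 show ?thesis by (simp add: add.commute)
  qed
qed

text \<open>
  At \<open>x\<close> and at \<open>a + b - x\<close> the weights of \<open>u a\<close> and \<open>u b\<close> are interchanged, so in the sum both get
  \<open>(sinh (h - d) + sinh (h + d)) / sinh (2 * h) = cosh d / cosh h\<close> with
  \<open>h = p * (b - a) / 2\<close> and \<open>d = p * (x - (a + b) / 2)\<close>.
\<close>

lemma hyperbolic_convex_on_reflected_sum_le:
  assumes u: "hyperbolic_convex_on p {a..b} u" and p: "p \<noteq> 0" and ab: "a < b"
    and x: "x \<in> {a..b}"
  shows "u x + u (a + b - x)
           \<le> cosh (p * (x - (a + b) / 2)) / cosh (p * (b - a) / 2) * (u a + u b)"
proof -
  define h where "h = p * (b - a) / 2"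
  define d where "d = p * (x - (a + b) / 2)"
  have h: "h \<noteq> 0" using p ab by (simp add: h_def)
  have *: "p * (b - a) = 2 * h" "p * (b - x) = h - d" "p * (x - a) = h + d"
    "p * (b - (a + b - x)) = h + d" "p * (a + b - x - a) = h - d"
    by (simp_all add: h_def d_def field_simps)
  have "u x \<le> sinh (h - d) / sinh (2 * h) * u a + sinh (h + d) / sinh (2 * h) * u b"
    using hyperbolic_convex_onD[OF u ab order_refl x] unfolding * .
  moreover have
    "u (a + b - x) \<le> sinh (h + d) / sinh (2 * h) * u a + sinh (h - d) / sinh (2 * h) * u b"
    using hyperbolic_convex_onD[OF u ab order_refl, of "a + b - x"] x unfolding * by simp
  ultimately have "u x + u (a + b - x)
      \<le> (sinh (h - d) + sinh (h + d)) / sinh (2 * h) * (u a + u b)"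
    by (simp add: algebra_simps add_divide_distrib)
  also have "(sinh (h - d) + sinh (h + d)) / sinh (2 * h) = cosh d / cosh h"
    using h unfolding sinh_double sinh_add sinh_diff by simp
  finally show ?thesis unfolding h_def d_def .
qed

section \<open>Boundedness and continuity\<close>

text \<open>
  The weights in the definition lie between 0 and 1, which bounds \<open>u\<close> above; together with the
  lower bound on \<open>u x + u (a + b - x)\<close>, the upper bound at the mirror image of \<open>x\<close> bounds \<open>u x\<close> below.
\<close>

lemma hyperbolic_convex_on_imp_bounded:
  assumes u: "hyperbolic_convex_on p {a..b} u" and p: "p \<noteq> 0" and ab: "a < b"
  shows "bounded (u ` {a..b})"
proof -
  let ?q = "\<bar>p\<bar>" and ?m = "(a + b) / 2"
  have q: "?q > 0" and uq: "hyperbolic_convex_on ?q {a..b} u"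
    using p u by (auto simp: hyperbolic_convex_on_abs)
  let ?M = "\<bar>u a\<bar> + \<bar>u b\<bar>"
  have up: "u x \<le> ?M" if x: "x \<in> {a..b}" for x
  proof -
    have c: "sinh (?q * s) / sinh (?q * (b - a)) * t \<le> \<bar>t\<bar>" if s: "0 \<le> s" "s \<le> b - a" for s t
    proof -
      have S: "sinh (?q * (b - a)) > 0" using q ab by simp
      have "0 \<le> sinh (?q * s)" "sinh (?q * s) \<le> sinh (?q * (b - a))"
        using q s by (simp_all add: mult_left_mono)
      then have r: "0 \<le> sinh (?q * s) / sinh (?q * (b - a))"
          "sinh (?q * s) / sinh (?q * (b - a)) \<le> 1"
        using S by simp_all
      have "sinh (?q * s) / sinh (?q * (b - a)) * t \<le> sinh (?q * s) / sinh (?q * (b - a)) * \<bar>t\<bar>"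
        using r by (intro mult_left_mono) auto
      also have "\<dots> \<le> 1 * \<bar>t\<bar>" using r by (intro mult_right_mono) auto
      finally show ?thesis by simp
    qed
    show ?thesis
      using hyperbolic_convex_onD[OF uq ab order_refl x] c[of "b - x" "u a"] c[of "x - a" "u b"] x
      by simp
  qed
  let ?L = "2 * cosh (?q * (b - a) / 2) * \<bar>u ?m\<bar> + ?M"
  have "\<bar>u x\<bar> \<le> ?L" if x: "x \<in> {a..b}" for x
  proof -
    have "\<bar>?q * (x - ?m)\<bar> \<le> \<bar>?q * (b - a) / 2\<bar>"
    proof -
      have "\<bar>x - ?m\<bar> \<le> (b - a) / 2" using x by (auto simp: abs_le_iff field_simps)
      then have "?q * \<bar>x - ?m\<bar> \<le> ?q * ((b - a) / 2)" by (rule mult_left_mono) simp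
      then show ?thesis using ab by (simp add: abs_mult)
    qed
    then have "cosh \<bar>?q * (x - ?m)\<bar> \<le> cosh \<bar>?q * (b - a) / 2\<bar>"
      by (subst cosh_real_nonneg_le_iff) auto
    then have "cosh (?q * (x - ?m)) \<le> cosh (?q * (b - a) / 2)"
      by (simp only: cosh_real_abs)
    then have "2 * cosh (?q * (x - ?m)) * \<bar>u ?m\<bar> \<le> 2 * cosh (?q * (b - a) / 2) * \<bar>u ?m\<bar>"
      by (intro mult_right_mono) auto
    moreover have "- (2 * cosh (?q * (x - ?m)) * \<bar>u ?m\<bar>) \<le> 2 * cosh (?q * (x - ?m)) * u ?m"
      using mult_left_mono[of "- \<bar>u ?m\<bar>" "u ?m" "2 * cosh (?q * (x - ?m))"] by simp
    moreover have "2 * cosh (?q * (x - ?m)) * u ?m \<le> u x + u (a + b - x)"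
      by (rule hyperbolic_convex_on_reflected_sum_ge[OF uq]) (use q x in auto)
    moreover have "u x \<le> ?M" "u (a + b - x) \<le> ?M" using up x by auto
    moreover have "0 \<le> 2 * cosh (?q * (b - a) / 2) * \<bar>u ?m\<bar>" by simp
    ultimately show ?thesis by linarith
  qed
  then show ?thesis unfolding bounded_iff real_norm_def by blast
qed

lemma tanh_artanh_real:
  fixes t :: real
  assumes "- 1 < t" "t < 1"
  shows "tanh (artanh t) = t"
proof -
  have "exp (- 2 * artanh t) = (1 - t) / (1 + t)"
    using assms by (simp add: artanh_def exp_minus)
  moreover have "(1 - (1 - t) / (1 + t)) / (1 + (1 - t) / (1 + t)) = t"
    using assms by (simp add: field_simps)
  ultimately show ?thesis
    unfolding tanh_real_altdef by simp
qed

lemma sinh_diff_eq_tanh: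
  fixes x y :: real
  shows "sinh (x - y) = cosh x * cosh y * (tanh x - tanh y)"
  by (simp add: tanh_def sinh_diff field_simps)

text \<open>
  Hyperbolic convexity compares \<open>u\<close> with combinations of \<open>cosh (p * x)\<close> and \<open>sinh (p * x)\<close>. Division
  by \<open>cosh (p * x)\<close> turns these into affine functions of \<open>tanh (p * x)\<close>: by \<open>sinh_diff_eq_tanh\<close>,
  the weights become those of ordinary convex combinations in this coordinate.
\<close>

lemma convex_on_tanh_coordinate:
  assumes u: "hyperbolic_convex_on p {a..b} u" and p: "p > 0"
  shows "convex_on {tanh (p * a)<..<tanh (p * b)} (\<lambda>t. u (artanh t / p) / cosh (artanh t))"
proof (rule convex_on_linorderI)
  fix t r s :: real
  assume t: "0 < t" "t < 1" and rs: "r \<in> {tanh (p * a)<..<tanh (p * b)}"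
    "s \<in> {tanh (p * a)<..<tanh (p * b)}" "r < s"
  define z where "z = (1 - t) * r + t * s"
  have zr: "z - r = t * (s - r)" and zs: "s - z = (1 - t) * (s - r)"
    by (simp_all add: z_def algebra_simps)
  then have rz: "r < z" "z < s"
    using t rs(3) by (smt (verit) mult_pos_pos)+
  have inv: "\<exists>x\<in>{a..b}. w = tanh (p * x)" if "w \<in> {tanh (p * a)<..<tanh (p * b)}" for w
  proof
    have "- 1 < w" "w < 1"
      using that tanh_real_gt_neg1[of "p * a"] tanh_real_lt_1[of "p * b"] by auto
    then have w: "tanh (artanh w) = w" by (rule tanh_artanh_real)
    then show "w = tanh (p * (artanh w / p))" using p by simp
    have "p * a < artanh w" "artanh w < p * b"
      using that w by (metis greaterThanLessThan_iff tanh_real_less_iff)+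
    then show "artanh w / p \<in> {a..b}" using p by (simp add: field_simps)
  qed
  obtain x y q where x: "x \<in> {a..b}" "r = tanh (p * x)" and y: "y \<in> {a..b}" "s = tanh (p * y)"
    and q: "q \<in> {a..b}" "z = tanh (p * q)"
    using inv[of r] inv[of s] inv[of z] rs rz by auto
  have o: "x < q" "q < y"
    using rz p unfolding x(2) y(2) q(2) by auto
  have "u q \<le> sinh (p * (y - q)) / sinh (p * (y - x)) * u x
            + sinh (p * (q - x)) / sinh (p * (y - x)) * u y"
    by (rule hyperbolic_convex_onD[OF u]) (use o x y in auto)
  also have "\<dots> = cosh (p * q) * ((1 - t) * (u x / cosh (p * x)) + t * (u y / cosh (p * y)))"
  proof -
    have "sinh (p * (y - q)) = cosh (p * y) * cosh (p * q) * ((1 - t) * (s - r))"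
      "sinh (p * (q - x)) = cosh (p * q) * cosh (p * x) * (t * (s - r))"
      "sinh (p * (y - x)) = cosh (p * y) * cosh (p * x) * (s - r)"
      unfolding zr[symmetric] zs[symmetric] right_diff_distrib[of p] sinh_diff_eq_tanh
      by (simp_all add: x(2) y(2) q(2))
    then have "sinh (p * (y - q)) / sinh (p * (y - x)) = cosh (p * q) * (1 - t) / cosh (p * x)"
      "sinh (p * (q - x)) / sinh (p * (y - x)) = cosh (p * q) * t / cosh (p * y)"
      using rs(3) by simp_all
    then show ?thesis by (simp add: distrib_left)
  qed
  finally have "u q / cosh (p * q) \<le> (1 - t) * (u x / cosh (p * x)) + t * (u y / cosh (p * y))"
    by (simp add: field_simps)
  moreover have "artanh r = p * x" "artanh s = p * y" "artanh z = p * q"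
    unfolding x y q by (simp_all add: artanh_tanh_real)
  ultimately show "u (artanh ((1 - t) *\<^sub>R r + t *\<^sub>R s) / p) / cosh (artanh ((1 - t) *\<^sub>R r + t *\<^sub>R s))
     \<le> (1 - t) * (u (artanh r / p) / cosh (artanh r)) + t * (u (artanh s / p) / cosh (artanh s))"
    using p unfolding real_scaleR_def z_def[symmetric] by simp
qed simp

text \<open>
  This cannot be extended to the closed interval: \<open>u\<close> may jump upwards at the end points.
\<close>

lemma hyperbolic_convex_on_imp_continuous_on:
  assumes u: "hyperbolic_convex_on p {a..b} u" and p: "p \<noteq> 0"
  shows "continuous_on {a<..<b} u"
proof -
  let ?q = "\<bar>p\<bar>" and ?g = "\<lambda>t. u (artanh t / \<bar>p\<bar>) / cosh (artanh t)"
  have q: "?q > 0" using p by simp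
  have uq: "hyperbolic_convex_on ?q {a..b} u"
    using u by (simp add: hyperbolic_convex_on_abs)
  have g: "continuous_on {tanh (?q * a)<..<tanh (?q * b)} ?g"
    by (rule convex_on_continuous[OF open_greaterThanLessThan convex_on_tanh_coordinate[OF uq q]])
  have tanh: "continuous_on {a<..<b} (\<lambda>x. tanh (?q * x))"
    by (intro continuous_intros) simp
  have "continuous_on {a<..<b} (\<lambda>x. ?g (tanh (?q * x)))"
    by (rule continuous_on_compose2[OF g tanh]) (use q in auto)
  moreover have "continuous_on {a<..<b} (\<lambda>x. cosh (?q * x))"
    by (intro continuous_intros)
  ultimately have "continuous_on {a<..<b} (\<lambda>x. cosh (?q * x) * ?g (tanh (?q * x)))"
    by (rule continuous_on_mult[rotated])
  moreover have "cosh (?q * x) * ?g (tanh (?q * x)) = u x" for x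
    using p by (simp add: artanh_tanh_real)
  ultimately show ?thesis by simp
qed

section \<open>Integrability\<close>

text \<open>
  Measurability of \<open>u\<close> comes from continuity and so only concerns the open interval; the end points
  do not affect integrability.
\<close>

lemma absolutely_integrable_hyperbolic_convex_mult:
  assumes u: "hyperbolic_convex_on p {a..b} u" and p: "p \<noteq> 0" and ab: "a < b"
    and g: "g absolutely_integrable_on {a..b}"
  shows "(\<lambda>x. u x * g x) absolutely_integrable_on {a..b}"
  unfolding absolutely_integrable_on_Icc_iff_Ioo
proof (rule absolutely_integrable_bounded_measurable_product_real)
  show "u \<in> borel_measurable (lebesgue_on {a<..<b})"
    using hyperbolic_convex_on_imp_continuous_on[OF u p] by (rule continuous_imp_measurable_on_sets_lebesgue) simp
  show "bounded (u ` {a<..<b})"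
    by (rule bounded_subset[OF hyperbolic_convex_on_imp_bounded[OF u p ab]]) auto
  show "g absolutely_integrable_on {a<..<b}"
    using g by (simp add: absolutely_integrable_on_Icc_iff_Ioo)
qed simp

lemma has_integral_reflect_Icc:
  fixes f :: "real \<Rightarrow> real"
  assumes "(f has_integral i) {a..b}"
  shows "((\<lambda>x. f (a + b - x)) has_integral i) {a..b}"
proof -
  have "((\<lambda>x. f (- x)) has_integral i) {- b..- a}" using assms by simp
  then have "((\<lambda>x. f (- (x + - (a + b)))) has_integral i) {a..b}"
    using has_integral_shift_Icc_real[of "\<lambda>x. f (- x)" "- (a + b)" i a b] by (simp add: o_def)
  then show ?thesis by (simp add: algebra_simps)
qed

text \<open>
  For \<open>\<alpha> \<ge> 1\<close> the kernel \<open>k\<close> is bounded. For \<open>\<alpha> < 1\<close> it is singular, but \<open>k * v\<close> is the integrand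
  of \<open>C1\<close> multiplied by a bounded function, because \<open>k\<close> is at most the sum of the two kernels
  and \<open>cosh\<close> is at least 1.
\<close>

lemma absolutely_integrable_RL_kernel_mult:
  fixes v :: "real \<Rightarrow> real"
  assumes ab: "a < b" and \<alpha>: "\<alpha> > 0"
    and v: "v absolutely_integrable_on {a..b}"
    and C: "\<alpha> < 1 \<Longrightarrow> C1_integrand p \<alpha> a b v absolutely_integrable_on {a..b}"
    and k: "k = (\<lambda>x. (b - x) powr (\<alpha> - 1)) \<or> k = (\<lambda>x. (x - a) powr (\<alpha> - 1))"
  shows "(\<lambda>x. k x * v x) absolutely_integrable_on {a..b}"
proof -
  have k_meas: "k \<in> borel_measurable borel" using k by auto
  show ?thesis
  proof (cases "\<alpha> < 1")
    case False
    have "\<bar>k x\<bar> \<le> (b - a) powr (\<alpha> - 1)" if "x \<in> {a..b}" for x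
      using k False that by (auto intro!: powr_mono2)
    then have "bounded (k ` {a..b})" unfolding bounded_iff real_norm_def by blast
    then show ?thesis
      using k_meas v
      by (intro absolutely_integrable_bounded_measurable_product_real measurable_restrict_space1
            measurable_completion) auto
  next
    case True
    let ?K = "\<lambda>x. (b - x) powr (\<alpha> - 1) + (x - a) powr (\<alpha> - 1)"
    let ?w = "\<lambda>x. Gamma \<alpha> * (k x / ?K x) / cosh (p * (x - (a + b) / 2))"
    have G: "Gamma \<alpha> > 0" using \<alpha> by (rule Gamma_real_pos)
    \<comment> \<open>Also at the end points, where one of the two summands is \<open>0 powr (\<alpha> - 1) = 0\<close>.\<close>
    have K: "?K x > 0" if "x \<in> {a..b}" for x
      using that ab by (cases "x = b") (auto intro!: add_pos_nonneg)
    have "\<bar>?w x\<bar> \<le> Gamma \<alpha>" if x: "x \<in> {a..b}" for x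
    proof -
      have "0 \<le> k x" "k x \<le> ?K x" using k by auto
      then have "0 \<le> k x / ?K x" "k x / ?K x \<le> 1" using K[OF x] by simp_all
      then have A: "Gamma \<alpha> * (k x / ?K x) \<le> Gamma \<alpha>" "0 \<le> Gamma \<alpha> * (k x / ?K x)"
        using G by (simp_all only: mult_left_le less_imp_le mult_nonneg_nonneg)
      have "0 \<le> ?w x"
        using A(2) cosh_real_nonneg by (rule divide_nonneg_nonneg)
      moreover have "?w x \<le> Gamma \<alpha> / 1"
        by (rule frac_le) (use A G cosh_real_ge_1 in auto)
      ultimately show ?thesis by simp
    qed
    then have "bounded (?w ` {a..b})" unfolding bounded_iff real_norm_def by blast
    moreover have cosh_meas: "(\<lambda>x. cosh (p * (x - (a + b) / 2))) \<in> borel_measurable borel"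
      by (intro borel_measurable_continuous_onI continuous_intros)
    have "?w \<in> borel_measurable borel"
      using k_meas cosh_meas by measurable
    ultimately have int: "(\<lambda>x. ?w x * C1_integrand p \<alpha> a b v x) absolutely_integrable_on {a..b}"
      by (intro absolutely_integrable_bounded_measurable_product_real measurable_restrict_space1
            measurable_completion C True) auto
    have "?w x * C1_integrand p \<alpha> a b v x = k x * v x" if "x \<in> {a..b}" for x
      using K[OF that] G unfolding C1_integrand_def by simp
    then show ?thesis
      by (rule set_integrable_cong[OF refl refl, THEN iffD1, OF _ int])
  qed
qed


section \<open>The fractional Hermite-Hadamard-Fejer inequality\<close>

theorem theorem2p3:
  fixes I :: "real set" and p \<alpha> a b :: real and u v :: "real \<Rightarrow> real"
  assumes "is_interval I"
    and "p \<noteq> 0"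
    and "\<alpha> > 0"
    and "hyperbolic_convex_on p I u"
    and "a \<in> I" and "b \<in> I" and "a < b"
    and "\<And>x. x \<in> {a..b} \<Longrightarrow> v x > 0"
    and "\<And>x. x \<in> {a..b} \<Longrightarrow> v (a + b - x) = v x"
    and "set_integrable lebesgue {a..b} v"
    \<comment> \<open>For \<open>\<alpha> < 1\<close> the kernels are singular, and integrability of \<open>v\<close> alone does not make
        the integral defining \<open>C1\<close> finite. For \<open>\<alpha> \<ge> 1\<close> nothing is assumed here.\<close>
    and "\<alpha> < 1 \<Longrightarrow> set_integrable lebesgue {a..b} (C1_integrand p \<alpha> a b v)"
  shows "u ((a + b) / 2) * C1 p \<alpha> a b v
           \<le> RL_left \<alpha> a (\<lambda>x. u x * v x) b + RL_right \<alpha> b (\<lambda>x. u x * v x) a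
       \<and> RL_left \<alpha> a (\<lambda>x. u x * v x) b + RL_right \<alpha> b (\<lambda>x. u x * v x) a
           \<le> (u a + u b) / 2 * (1 / cosh (p * (b - a) / 2)) * C1 p \<alpha> a b v"
proof -
  let ?m = "(a + b) / 2"
  have "{a..b} \<subseteq> I"
    using assms(1,5,6) by (meson atLeastAtMost_iff mem_is_interval_1_I subsetI)
  then have u: "hyperbolic_convex_on p {a..b} u"
    using assms(4) by (rule hyperbolic_convex_on_subset[rotated])
  let ?k1 = "\<lambda>x. (b - x) powr (\<alpha> - 1)" and ?k2 = "\<lambda>x. (x - a) powr (\<alpha> - 1)"
  define w where "w = (\<lambda>x. (?k1 x + ?k2 x) * v x)"
  have kv: "(\<lambda>x. ?k1 x * v x) absolutely_integrable_on {a..b}"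
    "(\<lambda>x. ?k2 x * v x) absolutely_integrable_on {a..b}"
    by (rule absolutely_integrable_RL_kernel_mult[OF assms(7,3,10,11)]; simp)+
  then have w_int: "w absolutely_integrable_on {a..b}"
    unfolding w_def distrib_right by (rule set_integral_add(1))
  have w_nonneg: "0 \<le> w x" if "x \<in> {a..b}" for x
    using assms(8)[OF that] by (auto simp: w_def)
  have w_sym: "w (a + b - x) = w x" if "x \<in> {a..b}" for x
    using assms(9)[OF that] by (simp add: w_def algebra_simps)
  have G: "Gamma \<alpha> > 0" using assms(3) by (rule Gamma_real_pos)

  have ukv: "(\<lambda>x. u x * (?k1 x * v x)) absolutely_integrable_on {a..b}"
    "(\<lambda>x. u x * (?k2 x * v x)) absolutely_integrable_on {a..b}"
    by (rule absolutely_integrable_hyperbolic_convex_mult[OF u assms(2,7)], rule kv)+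
  have uw: "(\<lambda>x. u x * w x) absolutely_integrable_on {a..b}"
    using w_int by (rule absolutely_integrable_hyperbolic_convex_mult[OF u assms(2,7)])
  define J where "J = integral {a..b} (\<lambda>x. u x * w x)"
  have J: "((\<lambda>x. u x * w x) has_integral J) {a..b}"
    unfolding J_def by (rule integrable_integral) (rule set_lebesgue_integral_eq_integral(1)[OF uw])
  have RL: "RL_left \<alpha> a (\<lambda>x. u x * v x) b + RL_right \<alpha> b (\<lambda>x. u x * v x) a = J / Gamma \<alpha>"
  proof -
    have "J = (LINT x:{a..b}|lebesgue. u x * (?k1 x * v x) + u x * (?k2 x * v x))"
      unfolding J_def set_lebesgue_integral_eq_integral(2)[OF uw, symmetric]
      by (simp add: w_def algebra_simps)
    also have "\<dots> = (LINT x:{a..b}|lebesgue. u x * (?k1 x * v x))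
                 + (LINT x:{a..b}|lebesgue. u x * (?k2 x * v x))"
      using ukv by (rule set_integral_add(2))
    finally show ?thesis
      unfolding RL_left_def RL_right_def by (simp add: mult.left_commute add_divide_distrib)
  qed

  have cw: "(\<lambda>x. cosh (p * (x - ?m)) * w x) absolutely_integrable_on {a..b}"
  proof (rule absolutely_integrable_bounded_measurable_product_real)
    have cont: "continuous_on {a..b} (\<lambda>x. cosh (p * (x - ?m)))"
      by (intro continuous_intros)
    then show "(\<lambda>x. cosh (p * (x - ?m))) \<in> borel_measurable (lebesgue_on {a..b})"
      by (rule continuous_imp_measurable_on_sets_lebesgue) simp
    show "bounded ((\<lambda>x. cosh (p * (x - ?m))) ` {a..b})"
      by (intro compact_imp_bounded compact_continuous_image cont compact_Icc)
  qed (use w_int in auto)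
  define D where "D = integral {a..b} (\<lambda>x. cosh (p * (x - ?m)) * w x)"
  have D: "((\<lambda>x. cosh (p * (x - ?m)) * w x) has_integral D) {a..b}"
    unfolding D_def by (rule integrable_integral) (rule set_lebesgue_integral_eq_integral(1)[OF cw])
  have C1: "C1 p \<alpha> a b v = D / Gamma \<alpha>"
  proof -
    have "C1 p \<alpha> a b v = (LINT x:{a..b}|lebesgue. cosh (p * (x - ?m)) * w x / Gamma \<alpha>)"
      unfolding C1_def C1_integrand_def w_def by (simp add: mult.assoc)
    also have "\<dots> = D / Gamma \<alpha>"
      unfolding D_def set_lebesgue_integral_eq_integral(2)[OF cw, symmetric] by simp
    finally show ?thesis .
  qed

  have "((\<lambda>x. u (a + b - x) * w (a + b - x)) has_integral J) {a..b}"
    using has_integral_reflect_Icc[OF J] .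
  then have "((\<lambda>x. u (a + b - x) * w x) has_integral J) {a..b}"
    by (rule has_integral_eq[rotated]) (simp add: w_sym)
  \<comment> \<open>Adding the reflected integral symmetrizes \<open>u\<close>, and the pointwise bounds apply.\<close>
  from has_integral_add[OF J this]
  have S: "((\<lambda>x. (u x + u (a + b - x)) * w x) has_integral 2 * J) {a..b}"
    by (simp add: distrib_right)
  have lower: "2 * u ?m * D \<le> 2 * J"
  proof (rule has_integral_le[OF has_integral_mult_right[OF D] S])
    fix x assume x: "x \<in> {a..b}"
    show "2 * u ?m * (cosh (p * (x - ?m)) * w x) \<le> (u x + u (a + b - x)) * w x"
      using mult_right_mono[OF hyperbolic_convex_on_reflected_sum_ge[OF u assms(2) x] w_nonneg[OF x]]
      by (simp add: ac_simps)
  qed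
  have upper: "2 * J \<le> (u a + u b) / cosh (p * (b - a) / 2) * D"
  proof (rule has_integral_le[OF S has_integral_mult_right[OF D]])
    fix x assume x: "x \<in> {a..b}"
    show "(u x + u (a + b - x)) * w x
        \<le> (u a + u b) / cosh (p * (b - a) / 2) * (cosh (p * (x - ?m)) * w x)"
      using mult_right_mono[OF hyperbolic_convex_on_reflected_sum_le[OF u assms(2,7) x] w_nonneg[OF x]]
      by (simp add: ac_simps)
  qed
  have "u ?m * D \<le> J" using lower by simp
  moreover have "J \<le> (u a + u b) / 2 * (1 / cosh (p * (b - a) / 2)) * D"
  proof -
    have "J = 2 * J / 2" by simp
    also have "\<dots> \<le> (u a + u b) / cosh (p * (b - a) / 2) * D / 2"
      using upper by (rule divide_right_mono) simp
    also have "\<dots> = (u a + u b) / 2 * (1 / cosh (p * (b - a) / 2)) * D" by simp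
    finally show ?thesis .
  qed
  ultimately show ?thesis
    unfolding RL C1 times_divide_eq_right
    using G by (metis divide_right_mono less_imp_le)
qed

end
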